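(* Let $r$ be either a positive integer or $r=\infty$. Let $(X,X')$ be a weakly$^*$ $\mathscr{C}^r$ triangulable pair, let $Y\subset\mathbb{R}^n$ be a weakly $\mathscr{C}^r$ triangulable set and let $f:X\to Y$ be a continuous map such that $f(X')$ is discrete and closed in $Y$. Then, there exists $g\in\mathscr{C}^r(X,Y)$ arbitrarily close to $f$ in the strong $\mathscr{C}^0$ topology such that $g|_{X'}=f|_{X'}$.
   Context: All subsets of Euclidean spaces carry the relative Euclidean topology; $\mathbb{R}^+:=\{t\in\mathbb{R}: t>0\}$. For $X\subset\mathbb{R}^m$ locally compact and $Y\subset\mathbb{R}^n$, a map $g:X\to Y$ is a $\mathscr{C}^r$ map if there exist an open neighborhood $U\subset\mathbb{R}^m$ of $X$ (in which $X$ is closed) and a map $G:U\to\mathbb{R}^n$ of class $\mathscr{C}^r$ in the standard sense such that $g(x)=G(x)$ for each $x\in X$. $\mathscr{C}^0(X,Y)$ (resp. $\mathscr{C}^r(X,Y)$) is the set of continuous (resp. $\mathscr{C}^r$) maps from $X$ to $Y$. The strong (Whitney) $\mathscr{C}^0$ topology on $\mathscr{C}^0(X,Y)$ has as fundamental system of neighborhoods of $f$ the sets $\{g\in\mathscr{C}^0(X,Y): \|g(x)-f(x)\|_n<\varepsilon(x)\ \forall x\in X\}$, where $\|\cdot\|_n$ is the Euclidean norm and $\varepsilon:X\to\mathbb{R}^+$ is a strictly positive continuous function. "There exists $g$ arbitrarily close to $f$" means that such a $g$ exists in every neighborhood of $f$ in this topology. A set $Y\subset\mathbb{R}^n$ is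 weakly $\mathscr{C}^r$ triangulable if there exist a locally finite simplicial complex $L$ of some $\mathbb{R}^q$ (each point of the realization $|L|$ has a neighborhood in $|L|$ meeting only finitely many simplices) and a homeomorphism $\Psi:|L|\to Y$ such that the restriction $\Psi|_\xi:\xi\to Y$ is a $\mathscr{C}^r$ map for each simplex $\xi\in L$. Let $X'\subset X\subset\mathbb{R}^m$ be sets such that $X$ is non-empty and $X'$ is closed in $X$. The pair $(X,X')$ is weakly$^*$ $\mathscr{C}^r$ triangulable if there exist a locally finite simplicial complex $K$ of some $\mathbb{R}^p$, a subcomplex $K'$ of $K$ and a homeomorphism $\Phi:|K|\to X$ such that $\Phi(|K'|)=X'$ and the restriction $\Phi|_{\sigma^0}:\sigma^0\to X$ is a $\mathscr{C}^r$ map for each open simplex $\sigma^0$ of $K$ (an open simplex of $K$ is a simplex of $K$ with its proper faces removed). *)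

theory Defs
  imports "HOL-Analysis.Analysis"
begin

text \<open>
  Euclidean spaces are types of class \<open>euclidean_space\<close>; subsets carry the topology
  \<open>top_of_set\<close>. A map \<open>X \<rightarrow> Y\<close> between subsets is a total function whose values
  outside \<open>X\<close> play no role.
\<close>

section \<open>Maps of class \<open>C\<^sup>r\<close>\<close>

text \<open>
  \<open>Ck_on k U G\<close> is meant for open \<open>U\<close>: the map \<open>G\<close> is \<open>C\<^sup>k\<^sup>+\<^sup>1\<close> iff it is differentiable
  and all its directional derivatives are \<open>C\<^sup>k\<close>.
\<close>

primrec Ck_on ::
  "nat \<Rightarrow> 'a::euclidean_space set \<Rightarrow> ('a \<Rightarrow> 'b::euclidean_space) \<Rightarrow> bool" where
  "Ck_on 0 U G \<longleftrightarrow> continuous_on U G"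
| "Ck_on (Suc k) U G \<longleftrightarrow>
     (\<forall>x\<in>U. G differentiable (at x)) \<and>
     (\<forall>v. Ck_on k U (\<lambda>x. frechet_derivative G (at x) v))"

definition Cr_on ::
  "enat \<Rightarrow> 'a::euclidean_space set \<Rightarrow> ('a \<Rightarrow> 'b::euclidean_space) \<Rightarrow> bool" where
  "Cr_on r U G \<longleftrightarrow> (\<forall>k. enat k \<le> r \<longrightarrow> Ck_on k U G)"

text \<open>
  Local compactness of \<open>X\<close> need not be required separately: it follows from \<open>X\<close> being closed
  in an open set.
\<close>

definition Cr_maps ::
  "enat \<Rightarrow> 'a::euclidean_space set \<Rightarrow> 'b::euclidean_space set \<Rightarrow> ('a \<Rightarrow> 'b) set" where
  "Cr_maps r X Y =
     {g. g ` X \<subseteq> Y \<and>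
         (\<exists>U G. open U \<and> closedin (top_of_set U) X \<and> Cr_on r U G \<and> (\<forall>x\<in>X. g x = G x))}"

definition C0_maps ::
  "'a::euclidean_space set \<Rightarrow> 'b::euclidean_space set \<Rightarrow> ('a \<Rightarrow> 'b) set" where
  "C0_maps X Y = {g. continuous_on X g \<and> g ` X \<subseteq> Y}"

section \<open>The strong topology\<close>

definition strong_nbhd ::
  "'a::euclidean_space set \<Rightarrow> 'b::euclidean_space set \<Rightarrow> ('a \<Rightarrow> 'b) \<Rightarrow> ('a \<Rightarrow> real) \<Rightarrow> ('a \<Rightarrow> 'b) set"
  where "strong_nbhd X Y f \<epsilon> = {g \<in> C0_maps X Y. \<forall>x\<in>X. norm (g x - f x) < \<epsilon> x}"

definition gauge_on :: "'a::euclidean_space set \<Rightarrow> ('a \<Rightarrow> real) \<Rightarrow> bool" where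
  "gauge_on X \<epsilon> \<longleftrightarrow> continuous_on X \<epsilon> \<and> (\<forall>x\<in>X. 0 < \<epsilon> x)"

definition strong_C0_topology ::
  "'a::euclidean_space set \<Rightarrow> 'b::euclidean_space set \<Rightarrow> ('a \<Rightarrow> 'b) topology" where
  "strong_C0_topology X Y =
     topology (\<lambda>W. W \<subseteq> C0_maps X Y \<and> (\<forall>f\<in>W. \<exists>\<epsilon>. gauge_on X \<epsilon> \<and> strong_nbhd X Y f \<epsilon> \<subseteq> W))"

lemma openin_strong_C0_topology:
  "openin (strong_C0_topology X Y) W \<longleftrightarrow>
     W \<subseteq> C0_maps X Y \<and> (\<forall>f\<in>W. \<exists>\<epsilon>. gauge_on X \<epsilon> \<and> strong_nbhd X Y f \<epsilon> \<subseteq> W)"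
proof -
  let ?P = "\<lambda>W. W \<subseteq> C0_maps X Y \<and> (\<forall>f\<in>W. \<exists>\<epsilon>. gauge_on X \<epsilon> \<and> strong_nbhd X Y f \<epsilon> \<subseteq> W)"
  have "istopology ?P"
    unfolding istopology_def
  proof (intro conjI allI impI ballI)
    fix S T f assume S: "?P S" and T: "?P T" and f: "f \<in> S \<inter> T"
    obtain \<epsilon> where \<epsilon>: "gauge_on X \<epsilon>" "strong_nbhd X Y f \<epsilon> \<subseteq> S" using S f by blast
    obtain \<delta> where \<delta>: "gauge_on X \<delta>" "strong_nbhd X Y f \<delta> \<subseteq> T" using T f by blast
    have "gauge_on X (\<lambda>x. min (\<epsilon> x) (\<delta> x))"
      using \<epsilon>(1) \<delta>(1) by (auto simp: gauge_on_def intro: continuous_on_min)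
    moreover have "strong_nbhd X Y f (\<lambda>x. min (\<epsilon> x) (\<delta> x)) \<subseteq> S \<inter> T"
      using \<epsilon>(2) \<delta>(2) unfolding strong_nbhd_def by auto
    ultimately show "\<exists>\<epsilon>. gauge_on X \<epsilon> \<and> strong_nbhd X Y f \<epsilon> \<subseteq> S \<inter> T" by blast
  next
    fix \<K> f assume \<K>: "\<forall>K\<in>\<K>. ?P K" and "f \<in> \<Union>\<K>"
    then obtain K where K: "K \<in> \<K>" "f \<in> K" by blast
    then obtain \<epsilon> where "gauge_on X \<epsilon>" "strong_nbhd X Y f \<epsilon> \<subseteq> K" using \<K> by blast
    then show "\<exists>\<epsilon>. gauge_on X \<epsilon> \<and> strong_nbhd X Y f \<epsilon> \<subseteq> \<Union>\<K>" using K by blast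
  qed blast+
  then show ?thesis
    unfolding strong_C0_topology_def by simp
qed

text \<open>The sets \<open>strong_nbhd X Y f \<epsilon>\<close> are a fundamental system of (open) neighbourhoods of \<open>f\<close>.\<close>

lemma openin_strong_nbhd:
  assumes f: "f \<in> C0_maps X Y" and \<epsilon>: "gauge_on X \<epsilon>"
  shows "openin (strong_C0_topology X Y) (strong_nbhd X Y f \<epsilon>)"
  unfolding openin_strong_C0_topology
proof (intro conjI ballI)
  show "strong_nbhd X Y f \<epsilon> \<subseteq> C0_maps X Y" by (auto simp: strong_nbhd_def)
next
  fix g assume g: "g \<in> strong_nbhd X Y f \<epsilon>"
  define \<delta> where "\<delta> x = \<epsilon> x - norm (g x - f x)" for x
  have "gauge_on X \<delta>"
    using f g \<epsilon> unfolding gauge_on_def strong_nbhd_def C0_maps_def \<delta>_def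
    by (auto intro!: continuous_intros)
  moreover have "strong_nbhd X Y g \<delta> \<subseteq> strong_nbhd X Y f \<epsilon>"
  proof
    fix h assume h: "h \<in> strong_nbhd X Y g \<delta>"
    have "norm (h x - f x) < \<epsilon> x" if "x \<in> X" for x
    proof -
      have "norm (h x - g x) < \<epsilon> x - norm (g x - f x)"
        using h that by (auto simp: strong_nbhd_def \<delta>_def)
      moreover have "norm (h x - f x) \<le> norm (h x - g x) + norm (g x - f x)"
        using norm_triangle_ineq[of "h x - g x" "g x - f x"] by simp
      ultimately show ?thesis by linarith
    qed
    then show "h \<in> strong_nbhd X Y f \<epsilon>" using h by (auto simp: strong_nbhd_def)
  qed
  ultimately show "\<exists>\<delta>. gauge_on X \<delta> \<and> strong_nbhd X Y g \<delta> \<subseteq> strong_nbhd X Y f \<epsilon>" by blast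
qed

lemma mem_strong_nbhd:
  "f \<in> C0_maps X Y \<Longrightarrow> gauge_on X \<epsilon> \<Longrightarrow> f \<in> strong_nbhd X Y f \<epsilon>"
  by (auto simp: strong_nbhd_def gauge_on_def)

lemma strong_nbhd_subset_openin:
  "openin (strong_C0_topology X Y) W \<Longrightarrow> f \<in> W \<Longrightarrow>
     \<exists>\<epsilon>. gauge_on X \<epsilon> \<and> strong_nbhd X Y f \<epsilon> \<subseteq> W"
  by (auto simp: openin_strong_C0_topology)

section \<open>Locally finite simplicial complexes and triangulability\<close>

text \<open>
  This is \<open>simplicial_complex\<close> with finiteness replaced by local finiteness in the realization
  \<open>\<Union>K\<close>. As there, the empty set counts as the simplex of dimension \<open>-1\<close> and as a face of
  every simplex.
\<close>

definition locally_finite_complex :: "'a::euclidean_space set set \<Rightarrow> bool" where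
  "locally_finite_complex K \<longleftrightarrow>
     (\<forall>S\<in>K. \<exists>n. n simplex S) \<and>
     (\<forall>F S. S \<in> K \<and> F face_of S \<longrightarrow> F \<in> K) \<and>
     (\<forall>S S'. S \<in> K \<and> S' \<in> K \<longrightarrow> (S \<inter> S') face_of S) \<and>
     locally_finite_in (top_of_set (\<Union>K)) K"

definition subcomplex :: "'a::euclidean_space set set \<Rightarrow> 'a set set \<Rightarrow> bool" where
  "subcomplex K' K \<longleftrightarrow> K' \<subseteq> K \<and> (\<forall>F S. S \<in> K' \<and> F face_of S \<longrightarrow> F \<in> K')"

definition open_simplex :: "'a::euclidean_space set \<Rightarrow> 'a set" where
  "open_simplex S = S - \<Union>{F. F face_of S \<and> F \<noteq> S}"

text \<open>
  The dimension of the space containing the complex cannot be quantified inside a formula, so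
  the space is a type argument \<open>'q\<close> (resp. \<open>'p\<close>). When triangulability is a hypothesis, a free
  type variable there is universally quantified over the whole theorem, which amounts to
  ``for some dimension'' in the hypothesis.
\<close>

definition weakly_Cr_triangulable ::
  "'q::euclidean_space itself \<Rightarrow> enat \<Rightarrow> 'b::euclidean_space set \<Rightarrow> bool" where
  "weakly_Cr_triangulable (_ :: 'q itself) r Y \<longleftrightarrow>
     (\<exists>(L :: 'q set set) \<Psi> \<Psi>'.
        locally_finite_complex L \<and>
        homeomorphism (\<Union>L) Y \<Psi> \<Psi>' \<and>
        (\<forall>\<xi>\<in>L. \<Psi> \<in> Cr_maps r \<xi> Y))"

definition weakly_star_Cr_triangulable_pair ::
  "'p::euclidean_space itself \<Rightarrow> enat \<Rightarrow> 'a::euclidean_space set \<Rightarrow> 'a set \<Rightarrow> bool" where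
  "weakly_star_Cr_triangulable_pair (_ :: 'p itself) r X X' \<longleftrightarrow>
     X \<noteq> {} \<and> closedin (top_of_set X) X' \<and>
     (\<exists>(K :: 'p set set) K' \<Phi> \<Phi>'.
        locally_finite_complex K \<and> subcomplex K' K \<and>
        homeomorphism (\<Union>K) X \<Phi> \<Phi>' \<and>
        \<Phi> ` (\<Union>K') = X' \<and>
        (\<forall>\<sigma>\<in>K. \<Phi> \<in> Cr_maps r (open_simplex \<sigma>) X))"

end

theory Submission
  imports Defs
begin

text \<open>
  Let \<open>\<Psi> : |L| \<rightarrow> Y\<close> be the triangulation of \<open>Y\<close>. The map \<open>\<Psi>\<close> is of class \<open>C\<^sup>r\<close> only on each closed
  simplex, so composing it with a smooth map \<open>h : X \<rightarrow> |L|\<close> gives a \<open>C\<^sup>r\<close> map provided that \<open>h\<close> sends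
  a neighbourhood of every point into a single simplex. The task is therefore to approximate
  \<open>F = \<Psi>\<inverse> \<circ> f\<close> by a smooth map of this kind.

  The key observation is that local finiteness of \<open>L\<close> gives every \<open>y \<in> |L|\<close> a ball such that each
  simplex meeting the ball contains \<open>y\<close> (\<open>locally_finite_complex_star_ball\<close>). Cover \<open>X\<close> by
  neighbourhoods \<open>W x\<close> so small that \<open>F\<close> maps \<open>W x\<close> into this ball for \<open>y = F x\<close>, and let \<open>h\<close> be the
  average \<open>\<Sum>i. \<phi> i *\<^sub>R F (x i)\<close> for a smooth partition of unity with supports in the \<open>W (x i)\<close>
  (\<open>smooth_average\<close>). If \<open>\<xi>\<close> is a simplex with \<open>F x0 \<in> \<xi>\<close>, then every \<open>F (x i)\<close> with \<open>x0 \<in> W (x i)\<close>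
  lies in \<open>\<xi>\<close>. Near \<open>x0\<close> no other indices contribute, and \<open>\<xi>\<close> is convex, so \<open>h\<close> maps a
  neighbourhood of \<open>x0\<close> into \<open>\<xi>\<close>. Shrinking the \<open>W x\<close> further makes \<open>\<Psi> \<circ> h\<close> as close to \<open>f\<close> as
  desired, with \<open>L\<close> kept fixed.

  For the condition on \<open>X'\<close>, choose \<open>W x\<close> disjoint from \<open>X'\<close> if \<open>x \<notin> X'\<close>, and such that \<open>f\<close> is
  constant on \<open>W x \<inter> X'\<close> if \<open>x \<in> X'\<close>, which discreteness of \<open>f ` X'\<close> permits
  (\<open>adapted_neighbourhood\<close>). At a point of \<open>X'\<close> all averaged values are then equal, so \<open>h = F\<close> there.
  The triangulation of \<open>X\<close> enters through local compactness (\<open>locally_compact_realization\<close>), which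
  provides an open set in which \<open>X\<close> is closed.

  The remaining work is the calculus of the predicate \<open>Ck_on\<close>, above all closure under
  composition (\<open>Ck_on_compose\<close>), and the construction of smooth partitions of unity.
\<close>

section \<open>Calculus of maps of class \<open>C\<^sup>k\<close>\<close>

lemma Ck_on_subset:
  "Ck_on k U G \<Longrightarrow> V \<subseteq> U \<Longrightarrow> Ck_on k V G"
proof (induction k arbitrary: G)
  case 0
  then show ?case by (auto intro: continuous_on_subset)
next
  case (Suc k)
  then show ?case by (simp add: subset_eq)
qed

lemma Ck_on_cong:
  assumes "open U" and "\<And>x. x \<in> U \<Longrightarrow> G x = H x" and "Ck_on k U G"
  shows "Ck_on k U H"
  using assms(2,3)
proof (induction k arbitrary: G H)
  case 0
  then show ?case by (simp cong: continuous_on_cong)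
next
  case (Suc k)
  have deriv: "(H has_derivative frechet_derivative G (at x)) (at x)" if "x \<in> U" for x
    using Suc.prems that frechet_derivative_works has_derivative_transform_within_open[OF _ \<open>open U\<close>]
    by (metis Ck_on.simps(2))
  then have eq: "frechet_derivative G (at x) = frechet_derivative H (at x)" if "x \<in> U" for x
    using that by (simp add: frechet_derivative_at)
  have "Ck_on k U (\<lambda>x. frechet_derivative H (at x) v)" for v
    using Suc.IH[of "\<lambda>x. frechet_derivative G (at x) v" "\<lambda>x. frechet_derivative H (at x) v"]
      Suc.prems eq by simp
  then show ?case
    using deriv by (auto simp: differentiable_def)
qed

lemma Ck_on_locally:
  assumes "\<And>x. x \<in> U \<Longrightarrow> \<exists>N. open N \<and> x \<in> N \<and> Ck_on k N G"
  shows "Ck_on k U G"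
  using assms
proof (induction k arbitrary: G)
  case 0
  then have "\<forall>x\<in>U. isCont G x"
    by (metis Ck_on.simps(1) continuous_on_eq_continuous_at)
  then show ?case by (simp add: continuous_at_imp_continuous_on)
next
  case (Suc k)
  have "G differentiable (at x)" if "x \<in> U" for x
    using Suc.prems[OF that] by auto
  moreover have "Ck_on k U (\<lambda>x. frechet_derivative G (at x) v)" for v
    by (rule Suc.IH) (metis Suc.prems Ck_on.simps(2))
  ultimately show ?case by simp
qed

lemma Ck_on_Suc_imp:
  "Ck_on (Suc k) U G \<Longrightarrow> Ck_on k U G"
proof (induction k arbitrary: G)
  case 0
  then show ?case
    by (auto intro!: continuous_at_imp_continuous_on differentiable_imp_continuous_within)
next
  case (Suc k)
  then show ?case
    by (metis Ck_on.simps(2))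
qed

text \<open>
  Once a candidate derivative is known, it decides the class; this replaces reasoning about
  \<open>frechet_derivative\<close>, which is only a choice operator.
\<close>

lemma Ck_on_SucI:
  assumes "open U" and "\<And>x. x \<in> U \<Longrightarrow> (G has_derivative G' x) (at x)"
    and "\<And>v. Ck_on k U (\<lambda>x. G' x v)"
  shows "Ck_on (Suc k) U G"
proof -
  have "frechet_derivative G (at x) = G' x" if "x \<in> U" for x
    using frechet_derivative_at[OF assms(2)[OF that]] by simp
  then have "Ck_on k U (\<lambda>x. frechet_derivative G (at x) v)" for v
    using Ck_on_cong[OF \<open>open U\<close> _ assms(3)[of v]] by simp
  then show ?thesis
    using assms(2) by (auto simp: differentiable_def)
qed

lemma Ck_on_SucE:
  assumes "Ck_on (Suc k) U G"
  obtains G' where "\<And>x. x \<in> U \<Longrightarrow> (G has_derivative G' x) (at x)"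
    and "\<And>v. Ck_on k U (\<lambda>x. G' x v)"
  using assms that[of "\<lambda>x. frechet_derivative G (at x)"] frechet_derivative_works by auto

lemma Ck_on_const:
  assumes "open U" shows "Ck_on k U (\<lambda>x. c)"
proof (induction k arbitrary: c)
  case (Suc k)
  show ?case by (rule Ck_on_SucI[OF assms, where G' = "\<lambda>x v. 0"]) (auto intro: Suc)
qed simp

lemma Ck_on_ident:
  assumes "open U" shows "Ck_on k U (\<lambda>x. x)"
proof (cases k)
  case (Suc k')
  show ?thesis unfolding Suc
    by (rule Ck_on_SucI[OF assms, where G' = "\<lambda>x v. v"]) (auto intro: Ck_on_const assms)
qed simp

lemma Ck_on_add:
  assumes "open U" "Ck_on k U G" "Ck_on k U H"
  shows "Ck_on k U (\<lambda>x. G x + H x)"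
  using assms(2,3)
proof (induction k arbitrary: G H)
  case 0
  then show ?case by (auto intro: continuous_intros)
next
  case (Suc k)
  obtain G' where G': "\<And>x. x \<in> U \<Longrightarrow> (G has_derivative G' x) (at x)"
      "\<And>v. Ck_on k U (\<lambda>x. G' x v)"
    using Suc.prems(1) Ck_on_SucE by blast
  obtain H' where H': "\<And>x. x \<in> U \<Longrightarrow> (H has_derivative H' x) (at x)"
      "\<And>v. Ck_on k U (\<lambda>x. H' x v)"
    using Suc.prems(2) Ck_on_SucE by blast
  show ?case
    by (rule Ck_on_SucI[OF assms(1), where G' = "\<lambda>x v. G' x v + H' x v"])
      (auto intro!: has_derivative_add G' H' Suc.IH)
qed

lemma Ck_on_sum:
  assumes "open U" "\<And>i. i \<in> I \<Longrightarrow> Ck_on k U (G i)"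
  shows "Ck_on k U (\<lambda>x. \<Sum>i\<in>I. G i x)"
  using assms(2)
proof (induction I rule: infinite_finite_induct)
  case (insert i I)
  then show ?case by (simp add: Ck_on_add assms(1))
qed (auto intro: Ck_on_const assms(1))

lemma Ck_on_bilinear:
  assumes B: "bounded_bilinear B" and "open U" "Ck_on k U G" "Ck_on k U H"
  shows "Ck_on k U (\<lambda>x. B (G x) (H x))"
  using assms(3,4)
proof (induction k arbitrary: G H)
  case 0
  then show ?case by (auto intro: bounded_bilinear.continuous_on[OF B])
next
  case (Suc k)
  obtain G' where G': "\<And>x. x \<in> U \<Longrightarrow> (G has_derivative G' x) (at x)"
      "\<And>v. Ck_on k U (\<lambda>x. G' x v)"
    using Suc.prems(1) Ck_on_SucE by blast
  obtain H' where H': "\<And>x. x \<in> U \<Longrightarrow> (H has_derivative H' x) (at x)"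
      "\<And>v. Ck_on k U (\<lambda>x. H' x v)"
    using Suc.prems(2) Ck_on_SucE by blast
  show ?case
  proof (rule Ck_on_SucI[OF assms(2), where G' = "\<lambda>x v. B (G x) (H' x v) + B (G' x v) (H x)"])
    show "Ck_on k U (\<lambda>x. B (G x) (H' x v) + B (G' x v) (H x))" for v
      using Suc.prems[THEN Ck_on_Suc_imp]
      by (intro Ck_on_add assms(2) Suc.IH G' H')
  qed (intro bounded_bilinear.FDERIV[OF B] G' H')
qed

lemmas Ck_on_mult = Ck_on_bilinear[OF bounded_bilinear_mult]
  and Ck_on_scaleR = Ck_on_bilinear[OF bounded_bilinear_scaleR]
  and Ck_on_inner = Ck_on_bilinear[OF bounded_bilinear_inner]

lemma Ck_on_diff:
  fixes G H :: "'a::euclidean_space \<Rightarrow> 'b::euclidean_space"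
  assumes "open U" "Ck_on k U G" "Ck_on k U H"
  shows "Ck_on k U (\<lambda>x. G x - H x)"
  using Ck_on_add[OF assms(1,2) Ck_on_scaleR[OF assms(1) Ck_on_const[OF assms(1), of k "- 1"] assms(3)]]
  by simp

lemma Ck_on_prod:
  fixes G :: "'i \<Rightarrow> 'a::euclidean_space \<Rightarrow> real"
  assumes "open U" "\<And>i. i \<in> I \<Longrightarrow> Ck_on k U (G i)"
  shows "Ck_on k U (\<lambda>x. \<Prod>i\<in>I. G i x)"
  using assms(2)
proof (induction I rule: infinite_finite_induct)
  case (insert i I)
  then show ?case by (simp add: Ck_on_mult assms(1))
qed (auto intro: Ck_on_const assms(1))

text \<open>
  Expanding \<open>H' x v\<close> in the standard basis turns the derivative \<open>G' (H x) (H' x v)\<close> of a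
  composition into a finite sum of products of maps that are \<open>C\<^sup>k\<close> by induction.
\<close>

lemma Ck_on_compose:
  assumes "open U" "open V" "H ` U \<subseteq> V" "Ck_on k V G" "Ck_on k U H"
  shows "Ck_on k U (\<lambda>x. G (H x))"
  using assms(4,5)
proof (induction k arbitrary: G)
  case 0
  then show ?case
    using assms(3) by (auto intro: continuous_on_compose2)
next
  case (Suc k)
  obtain G' where G': "\<And>x. x \<in> V \<Longrightarrow> (G has_derivative G' x) (at x)"
      "\<And>v. Ck_on k V (\<lambda>x. G' x v)"
    using Suc.prems(1) Ck_on_SucE by blast
  obtain H' where H': "\<And>x. x \<in> U \<Longrightarrow> (H has_derivative H' x) (at x)"
      "\<And>v. Ck_on k U (\<lambda>x. H' x v)"
    using Suc.prems(2) Ck_on_SucE by blast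
  show ?case
  proof (rule Ck_on_SucI[OF assms(1), where G' = "\<lambda>x v. \<Sum>b\<in>Basis. (H' x v \<bullet> b) *\<^sub>R G' (H x) b"])
    fix x assume x: "x \<in> U"
    then have Hx: "H x \<in> V" using assms(3) by auto
    have "((\<lambda>x. G (H x)) has_derivative (\<lambda>v. G' (H x) (H' x v))) (at x)"
      using diff_chain_at[OF H'(1)[OF x] G'(1)[OF Hx]] by (simp add: o_def)
    moreover have "G' (H x) (H' x v) = (\<Sum>b\<in>Basis. (H' x v \<bullet> b) *\<^sub>R G' (H x) b)" for v
    proof -
      interpret linear "G' (H x)"
        using G'(1)[OF Hx] has_derivative_linear by blast
      have "G' (H x) (H' x v) = G' (H x) (\<Sum>b\<in>Basis. (H' x v \<bullet> b) *\<^sub>R b)"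
        by (simp add: euclidean_representation)
      then show ?thesis by (simp add: sum scale)
    qed
    ultimately show "((\<lambda>x. G (H x)) has_derivative
        (\<lambda>v. \<Sum>b\<in>Basis. (H' x v \<bullet> b) *\<^sub>R G' (H x) b)) (at x)"
      by simp
  next
    fix v
    show "Ck_on k U (\<lambda>x. \<Sum>b\<in>Basis. (H' x v \<bullet> b) *\<^sub>R G' (H x) b)"
      using Suc.prems(2)[THEN Ck_on_Suc_imp]
      by (intro Ck_on_sum Ck_on_scaleR Ck_on_inner Ck_on_const Suc.IH G' H' assms(1))
  qed
qed

section \<open>Smooth bump functions\<close>

text \<open>
  The case \<open>n = 0\<close> is the classical smooth function that vanishes exactly for \<open>t \<le> 0\<close>. Allowing
  all \<open>n\<close> makes the family closed under differentiation, up to linear combinations, so that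
  smoothness of all its members follows by one induction.
\<close>

definition flat :: "nat \<Rightarrow> real \<Rightarrow> real" where
  "flat n t = (if t > 0 then exp (- inverse t) * inverse t ^ n else 0)"

lemma flat_tendsto_0: "(flat n \<longlongrightarrow> 0) (at 0)"
proof -
  have "((\<lambda>t::real. inverse t ^ n / exp (inverse t)) \<longlongrightarrow> 0) (at_right 0)"
    by (rule filterlim_compose[OF tendsto_power_div_exp_0 filterlim_inverse_at_top_right])
  then have "(flat n \<longlongrightarrow> 0) (at_right 0)"
    by (rule Lim_transform_eventually)
      (auto simp: eventually_at_filter flat_def exp_minus field_simps)
  moreover have "(flat n \<longlongrightarrow> 0) (at_left 0)"
    by (rule tendsto_eventually) (auto simp: eventually_at_filter flat_def)
  ultimately show ?thesis
    by (simp add: filterlim_split_at)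
qed

lemma flat_has_derivative:
  "(flat n has_real_derivative flat (n + 2) t - real n * flat (n + 1) t) (at t)"
proof -
  consider "t > 0" | "t < 0" | "t = 0" by linarith
  then show ?thesis
  proof cases
    case 1
    have "((\<lambda>t. exp (- inverse t) * inverse t ^ n) has_real_derivative
        exp (- inverse t) * (inverse t)\<^sup>2 * inverse t ^ n
          - exp (- inverse t) * (real n * inverse t ^ (n - 1) * (inverse t)\<^sup>2)) (at t)"
      using 1 by (auto intro!: derivative_eq_intros simp: power2_eq_square)
    also have "exp (- inverse t) * (inverse t)\<^sup>2 * inverse t ^ n
          - exp (- inverse t) * (real n * inverse t ^ (n - 1) * (inverse t)\<^sup>2)
        = flat (n + 2) t - real n * flat (n + 1) t"
      using 1 by (cases n) (simp_all add: flat_def power2_eq_square)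
    finally have "((\<lambda>t. exp (- inverse t) * inverse t ^ n) has_real_derivative
        flat (n + 2) t - real n * flat (n + 1) t) (at t)" .
    then show ?thesis
      by (rule has_field_derivative_transform_within_open[where S = "{0<..}"])
        (use 1 in \<open>auto simp: flat_def\<close>)
  next
    case 2
    have "((\<lambda>t. 0) has_real_derivative flat (n + 2) t - real n * flat (n + 1) t) (at t)"
      using 2 by (simp add: flat_def)
    then show ?thesis
      by (rule has_field_derivative_transform_within_open[where S = "{..<0}"])
        (use 2 in \<open>auto simp: flat_def\<close>)
  next
    case 3
    have "(flat n has_real_derivative 0) (at 0)"
      unfolding has_field_derivative_iff
      by (rule Lim_transform_eventually[OF flat_tendsto_0[of "Suc n"]])
        (auto simp: eventually_at_filter flat_def field_simps)
    then show ?thesis using 3 by (simp add: flat_def)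
  qed
qed

lemma Ck_on_flat: "Ck_on k UNIV (flat n)"
proof (induction k arbitrary: n)
  case 0
  have "isCont (flat n) t" for t
    using flat_has_derivative DERIV_isCont by blast
  then show ?case by (simp add: continuous_at_imp_continuous_on)
next
  case (Suc k)
  show ?case
  proof (rule Ck_on_SucI[where G' = "\<lambda>t v. (flat (n + 2) t - real n * flat (n + 1) t) * v"])
    show "(flat n has_derivative (*) (flat (n + 2) t - real n * flat (n + 1) t)) (at t)" for t
      using flat_has_derivative by (simp add: has_field_derivative_def)
    show "Ck_on k UNIV (\<lambda>t. (flat (n + 2) t - real n * flat (n + 1) t) * v)" for v
      by (intro Ck_on_mult Ck_on_diff Ck_on_const Suc open_UNIV)
  qed simp
qed

text \<open>
  Iterating the flat function gives the step \<open>\<lambda>t. flat 0 (b - flat 0 t) / flat 0 b\<close> with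
  \<open>b = flat 0 T\<close>: it is \<open>1\<close> for \<open>t \<le> 0\<close> and \<open>0\<close> for \<open>t \<ge> T\<close>. Composed with a shifted squared
  distance it yields the bump, and no quotient of functions has to be differentiated.
\<close>

lemma smooth_bump:
  fixes a :: "'a::euclidean_space"
  assumes "\<rho> > 0"
  shows "\<exists>c :: 'a \<Rightarrow> real. (\<forall>k. Ck_on k UNIV c) \<and> (\<forall>x. 0 \<le> c x) \<and> (\<forall>x. c x \<le> 1) \<and>
    (\<forall>x. dist a x < \<rho> / 2 \<longrightarrow> c x = 1) \<and> (\<forall>x. \<rho> \<le> dist a x \<longrightarrow> c x = 0)"
proof -
  define b where "b = flat 0 (\<rho>\<^sup>2 / 2)"
  define q where "q x = (x - a) \<bullet> (x - a) - \<rho>\<^sup>2 / 4" for x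
  define c where "c x = inverse (flat 0 b) * flat 0 (b - flat 0 (q x))" for x
  have mono: "flat 0 s \<le> flat 0 t" if "s \<le> t" for s t
    using that by (auto simp: flat_def le_imp_inverse_le)
  have nonneg: "0 \<le> flat 0 t" for t by (simp add: flat_def)
  have "b > 0" using assms by (simp add: b_def flat_def)
  then have pos: "flat 0 b > 0" by (simp add: flat_def)
  have q: "q x = (dist a x)\<^sup>2 - \<rho>\<^sup>2 / 4" for x
    by (simp add: q_def dist_norm power2_norm_eq_inner inner_diff inner_commute)
  show ?thesis
  proof (intro exI[of _ c] conjI allI impI)
    show "Ck_on k UNIV c" for k
    proof -
      have "Ck_on k UNIV q"
        unfolding q_def by (intro Ck_on_diff Ck_on_inner Ck_on_ident Ck_on_const open_UNIV)
      then have "Ck_on k UNIV (\<lambda>x. flat 0 (q x))"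
        using Ck_on_compose[OF open_UNIV open_UNIV _ Ck_on_flat, of q k 0] by simp
      then have "Ck_on k UNIV (\<lambda>x. b - flat 0 (q x))"
        by (intro Ck_on_diff Ck_on_const open_UNIV)
      then have "Ck_on k UNIV (\<lambda>x. flat 0 (b - flat 0 (q x)))"
        using Ck_on_compose[OF open_UNIV open_UNIV _ Ck_on_flat, of "\<lambda>x. b - flat 0 (q x)" k 0]
        by simp
      then show ?thesis
        unfolding c_def by (intro Ck_on_mult Ck_on_const open_UNIV)
    qed
    show "0 \<le> c x" for x using pos nonneg by (simp add: c_def)
    show "c x \<le> 1" for x
      using mono[of "b - flat 0 (q x)" b] nonneg[of "q x"] pos by (simp add: c_def field_simps)
    show "c x = 1" if "dist a x < \<rho> / 2" for x
    proof -
      have "(dist a x)\<^sup>2 \<le> (\<rho> / 2)\<^sup>2" using that by (intro power_mono) auto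
      then have "flat 0 (q x) = 0" by (simp add: q flat_def power_divide)
      then show ?thesis using pos by (simp add: c_def)
    qed
    show "c x = 0" if "\<rho> \<le> dist a x" for x
    proof -
      have "\<rho>\<^sup>2 \<le> (dist a x)\<^sup>2" using that assms by (intro power_mono) auto
      then have "\<rho>\<^sup>2 / 2 \<le> q x" unfolding q by (simp add: field_simps) (smt (verit) zero_le_power2)
      then have "b \<le> flat 0 (q x)" unfolding b_def by (rule mono)
      then show ?thesis by (simp add: c_def flat_def)
    qed
  qed
qed

section \<open>Smooth partitions of unity\<close>

text \<open>
  Take a countable subfamily of bumps \<open>c i\<close>, supported in \<open>W (a i)\<close>, whose plateaus \<open>B i\<close> cover
  \<open>X\<close>, and put \<open>\<phi> i = c i * (\<Prod>j<i. 1 - c j)\<close>. The sums telescope,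
  \<open>(\<Sum>i\<le>n. \<phi> i) = 1 - (\<Prod>i\<le>n. 1 - c i)\<close>, and the product vanishes on \<open>B j\<close> as soon as
  \<open>n \<ge> j\<close>. Hence on \<open>B j\<close> only the first \<open>j + 1\<close> functions matter, which gives local finiteness
  without refining the cover.
\<close>

lemma smooth_partition_of_unity:
  fixes X :: "'a::euclidean_space set"
  assumes "X \<noteq> {}" and W: "\<And>x. x \<in> X \<Longrightarrow> open (W x) \<and> x \<in> W x"
  obtains a :: "nat \<Rightarrow> 'a" and B :: "nat \<Rightarrow> 'a set" and \<phi> :: "nat \<Rightarrow> 'a \<Rightarrow> real"
  where "\<And>i. a i \<in> X" "\<And>i. open (B i)" "X \<subseteq> (\<Union>i. B i)"
    "\<And>k i. Ck_on k UNIV (\<phi> i)" "\<And>i x. 0 \<le> \<phi> i x"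
    "\<And>i. closure {x. \<phi> i x \<noteq> 0} \<subseteq> W (a i)"
    "\<And>j x. x \<in> B j \<Longrightarrow> (\<Sum>i\<le>j. \<phi> i x) = 1"
    "\<And>i j x. x \<in> B j \<Longrightarrow> j < i \<Longrightarrow> \<phi> i x = 0"
proof -
  have "\<exists>\<rho>>0. cball x \<rho> \<subseteq> W x" if "x \<in> X" for x
    using W[OF that] open_contains_cball by blast
  then obtain \<rho> where \<rho>: "\<And>x. x \<in> X \<Longrightarrow> \<rho> x > 0" "\<And>x. x \<in> X \<Longrightarrow> cball x (\<rho> x) \<subseteq> W x"
    by metis
  define plateau where "plateau x = ball x (\<rho> x / 2)" for x
  obtain \<F> where \<F>: "\<F> \<subseteq> plateau ` X" "countable \<F>" "\<Union>\<F> = \<Union>(plateau ` X)"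
    by (rule Lindelof[of "plateau ` X"]) (auto simp: plateau_def)
  have cover: "X \<subseteq> \<Union>\<F>"
    unfolding \<F>(3) using \<rho>(1) by (force simp: plateau_def)
  with \<open>X \<noteq> {}\<close> have "\<F> \<noteq> {}" by auto
  define B where "B = from_nat_into \<F>"
  have range_B: "range B = \<F>"
    using \<F>(2) \<open>\<F> \<noteq> {}\<close> by (simp add: B_def range_from_nat_into)
  then have "\<exists>x\<in>X. B i = plateau x" for i
    using \<F>(1) by blast
  then obtain a where a: "\<And>i. a i \<in> X" "\<And>i. B i = plateau (a i)"
    by metis
  have "\<exists>c :: 'a \<Rightarrow> real. (\<forall>k. Ck_on k UNIV c) \<and> (\<forall>x. 0 \<le> c x) \<and> (\<forall>x. c x \<le> 1) \<and>
      (\<forall>x. dist (a i) x < \<rho> (a i) / 2 \<longrightarrow> c x = 1) \<and> (\<forall>x. \<rho> (a i) \<le> dist (a i) x \<longrightarrow> c x = 0)" for i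
    by (rule smooth_bump[OF \<rho>(1)[OF a(1)]])
  then obtain c :: "nat \<Rightarrow> 'a \<Rightarrow> real" where
    c: "\<And>k i. Ck_on k UNIV (c i)" "\<And>i x. 0 \<le> c i x" "\<And>i x. c i x \<le> 1"
      "\<And>i x. dist (a i) x < \<rho> (a i) / 2 \<Longrightarrow> c i x = 1"
      "\<And>i x. \<rho> (a i) \<le> dist (a i) x \<Longrightarrow> c i x = 0"
    by metis
  define \<phi> where "\<phi> i x = c i x * (\<Prod>j<i. 1 - c j x)" for i x
  have c_B: "c j x = 1" if "x \<in> B j" for j x
    using that c(4) by (simp add: a(2) plateau_def)
  have telescope: "(\<Sum>i\<le>n. \<phi> i x) = 1 - (\<Prod>i\<le>n. 1 - c i x)" for n x
    by (induction n) (simp_all add: \<phi>_def lessThan_Suc_atMost algebra_simps)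
  show thesis
  proof
    show "a i \<in> X" for i by (rule a)
    show "open (B i)" for i by (simp add: a(2) plateau_def)
    show "X \<subseteq> (\<Union>i. B i)" using cover range_B by simp
    show "Ck_on k UNIV (\<phi> i)" for k i
      unfolding \<phi>_def by (intro Ck_on_mult Ck_on_prod Ck_on_diff Ck_on_const c open_UNIV)
    show "0 \<le> \<phi> i x" for i x
      unfolding \<phi>_def using c(2,3) by (auto intro!: mult_nonneg_nonneg prod_nonneg)
    show "closure {x. \<phi> i x \<noteq> 0} \<subseteq> W (a i)" for i
    proof -
      have "\<phi> i x = 0" if "x \<notin> cball (a i) (\<rho> (a i))" for x
        using that c(5)[of i x] by (simp add: \<phi>_def)
      then have "closure {x. \<phi> i x \<noteq> 0} \<subseteq> cball (a i) (\<rho> (a i))"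
        by (intro closure_minimal closed_cball) blast
      then show ?thesis using \<rho>(2)[OF a(1)] by blast
    qed
    show "(\<Sum>i\<le>j. \<phi> i x) = 1" if "x \<in> B j" for j x
      using c_B[OF that] by (auto simp: telescope)
    show "\<phi> i x = 0" if "x \<in> B j" "j < i" for i j x
      using c_B[OF that(1)] that(2) by (auto simp: \<phi>_def)
  qed
qed

text \<open>
  Averaging values \<open>p i\<close> with the weights of a partition of unity: on \<open>B j\<close> the average is the
  finite sum up to \<open>j\<close>, so it is smooth there; the value at \<open>x\<close> is defined through the first
  plateau that contains \<open>x\<close>. Near \<open>x0\<close> only those indices contribute whose support contains
  \<open>x0\<close>, which are finitely many. So the average stays near \<open>x0\<close>, and not only at \<open>x0\<close>, in the
  convex hull of the values attached to sets \<open>W x\<close> that contain \<open>x0\<close>.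
\<close>

lemma smooth_average:
  fixes X :: "'a::euclidean_space set" and p :: "'a \<Rightarrow> 'b::euclidean_space"
  assumes "X \<noteq> {}" and W: "\<And>x. x \<in> X \<Longrightarrow> open (W x) \<and> x \<in> W x"
  shows "\<exists>h :: 'a \<Rightarrow> 'b. \<forall>x0\<in>X. \<exists>N A. open N \<and> x0 \<in> N \<and> (\<forall>k. Ck_on k N h) \<and>
        finite A \<and> A \<subseteq> {x \<in> X. x0 \<in> W x} \<and> h ` N \<subseteq> convex hull (p ` A)"
proof -
  obtain a B and \<phi> :: "nat \<Rightarrow> 'a \<Rightarrow> real"
    where a: "\<And>i. a i \<in> X" and B: "\<And>i. open (B i)" "X \<subseteq> (\<Union>i. B i)"
    and \<phi>: "\<And>k i. Ck_on k UNIV (\<phi> i)" "\<And>i x. 0 \<le> \<phi> i x"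
      "\<And>i. closure {x. \<phi> i x \<noteq> 0} \<subseteq> W (a i)"
      "\<And>j x. x \<in> B j \<Longrightarrow> (\<Sum>i\<le>j. \<phi> i x) = 1"
      "\<And>i j x. x \<in> B j \<Longrightarrow> j < i \<Longrightarrow> \<phi> i x = 0"
    using smooth_partition_of_unity[of X W] assms by blast
  define avg where "avg j x = (\<Sum>i\<le>j. \<phi> i x *\<^sub>R p (a i))" for j x
  define h where "h x = avg (LEAST j. x \<in> B j) x" for x
  have h_eq: "h x = avg j x" if "x \<in> B j" for j x
  proof -
    let ?l = "LEAST j. x \<in> B j"
    have l: "x \<in> B ?l" "?l \<le> j"
      using that by (auto intro: LeastI Least_le)
    have "avg j x = avg ?l x"
      unfolding avg_def
      by (rule sum.mono_neutral_right) (use l \<phi>(5)[OF l(1)] in auto)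
    then show ?thesis by (simp add: h_def)
  qed
  show ?thesis
  proof (intro exI[of _ h] ballI)
    fix x0 assume "x0 \<in> X"
    then obtain j where j: "x0 \<in> B j" using B(2) by blast
    define I where "I = {i. i \<le> j \<and> x0 \<notin> W (a i)}"
    define N where "N = B j - (\<Union>i\<in>I. closure {x. \<phi> i x \<noteq> 0})"
    define A where "A = a ` ({..j} - I)"
    have "finite I" by (simp add: I_def)
    have "open N"
      unfolding N_def by (intro open_Diff B closed_UN \<open>finite I\<close> ballI closed_closure)
    moreover have "x0 \<in> N"
      using j \<phi>(3) by (auto simp: N_def I_def)
    moreover have "Ck_on k N h" for k
    proof (rule Ck_on_cong[OF \<open>open N\<close>])
      show "avg j x = h x" if "x \<in> N" for x
        using that h_eq[of x j] by (simp add: N_def)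
      have "Ck_on k UNIV (avg j)"
        unfolding avg_def by (intro Ck_on_sum Ck_on_scaleR Ck_on_const \<phi> open_UNIV)
      then show "Ck_on k N (avg j)" by (rule Ck_on_subset) simp
    qed
    moreover have "finite A" "A \<subseteq> {x \<in> X. x0 \<in> W x}"
      using a by (auto simp: A_def I_def)
    moreover have "h ` N \<subseteq> convex hull (p ` A)"
    proof clarify
      fix x assume x: "x \<in> N"
      then have "x \<in> B j" by (simp add: N_def)
      have zero: "\<phi> i x = 0" if "i \<in> I" for i
        using x that closure_subset[of "{x. \<phi> i x \<noteq> 0}"] by (auto simp: N_def)
      have "(\<Sum>i\<in>{..j} - I. \<phi> i x) = (\<Sum>i\<le>j. \<phi> i x)"
        by (rule sum.mono_neutral_left) (auto simp: zero)
      then have "(\<Sum>i\<in>{..j} - I. \<phi> i x *\<^sub>R p (a i)) \<in> convex hull (p ` A)"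
        using \<phi>(4)[OF \<open>x \<in> B j\<close>]
        by (intro convex_sum) (auto simp: A_def \<phi>(2) hull_inc)
      moreover have "(\<Sum>i\<in>{..j} - I. \<phi> i x *\<^sub>R p (a i)) = avg j x"
        unfolding avg_def by (rule sum.mono_neutral_left) (auto simp: zero)
      ultimately show "h x \<in> convex hull (p ` A)"
        using h_eq[OF \<open>x \<in> B j\<close>] by simp
    qed
    ultimately show "\<exists>N A. open N \<and> x0 \<in> N \<and> (\<forall>k. Ck_on k N h) \<and>
        finite A \<and> A \<subseteq> {x \<in> X. x0 \<in> W x} \<and> h ` N \<subseteq> convex hull (p ` A)"
      by blast
  qed
qed

section \<open>Locally finite complexes\<close>

text \<open>
  The simplices that miss \<open>y\<close> and come near it are finitely many closed sets, so a small ball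
  around \<open>y\<close> avoids all of them.
\<close>

lemma locally_finite_complex_star_ball:
  assumes "locally_finite_complex L" "y \<in> \<Union>L"
  obtains e where "e > 0" "\<And>\<xi> z. \<xi> \<in> L \<Longrightarrow> z \<in> \<xi> \<Longrightarrow> dist z y < e \<Longrightarrow> y \<in> \<xi>"
proof -
  obtain V where V: "openin (top_of_set (\<Union>L)) V" "y \<in> V" "finite {\<xi> \<in> L. \<xi> \<inter> V \<noteq> {}}"
    using assms unfolding locally_finite_complex_def locally_finite_in_def
    by (metis topspace_euclidean_subtopology)
  then obtain T where T: "open T" "V = \<Union>L \<inter> T"
    by (auto simp: openin_open)
  define D where "D = \<Union>{\<xi> \<in> L. \<xi> \<inter> V \<noteq> {} \<and> y \<notin> \<xi>}"
  have "closed D"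
    unfolding D_def
  proof (rule closed_Union)
    show "finite {\<xi> \<in> L. \<xi> \<inter> V \<noteq> {} \<and> y \<notin> \<xi>}"
      by (rule finite_subset[OF _ V(3)]) auto
    show "\<forall>\<xi>\<in>{\<xi> \<in> L. \<xi> \<inter> V \<noteq> {} \<and> y \<notin> \<xi>}. closed \<xi>"
      using assms(1) closed_simplex unfolding locally_finite_complex_def by blast
  qed
  then have "open (T - D)" "y \<in> T - D"
    using T V(2) by (auto simp: D_def)
  then obtain e where e: "e > 0" "ball y e \<subseteq> T - D"
    using open_contains_ball by blast
  show thesis
  proof
    show "y \<in> \<xi>" if "\<xi> \<in> L" "z \<in> \<xi>" "dist z y < e" for \<xi> z
    proof (rule ccontr)
      assume "y \<notin> \<xi>"
      have "z \<in> T - D" using that e(2) by (auto simp: dist_commute)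
      moreover have "z \<in> D" if "z \<in> T"
        using that T \<open>\<xi> \<in> L\<close> \<open>z \<in> \<xi>\<close> \<open>y \<notin> \<xi>\<close> by (auto simp: D_def)
      ultimately show False by blast
    qed
  qed (rule e)
qed

lemma locally_compact_realization:
  assumes "locally_finite_complex K"
  shows "locally compact (\<Union>K)"
  unfolding locally_compact
proof
  fix y assume "y \<in> \<Union>K"
  then obtain V where V: "openin (top_of_set (\<Union>K)) V" "y \<in> V" "finite {\<xi> \<in> K. \<xi> \<inter> V \<noteq> {}}"
    using assms unfolding locally_finite_complex_def locally_finite_in_def
    by (metis topspace_euclidean_subtopology)
  let ?C = "\<Union>{\<xi> \<in> K. \<xi> \<inter> V \<noteq> {}}"
  have "compact ?C"
    using assms V(3) compact_simplex unfolding locally_finite_complex_def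
    by (intro compact_Union) blast+
  moreover have "V \<subseteq> ?C" "?C \<subseteq> \<Union>K"
    using openin_imp_subset[OF V(1)] by blast+
  ultimately show "\<exists>U C. y \<in> U \<and> U \<subseteq> C \<and> C \<subseteq> \<Union>K \<and> openin (top_of_set (\<Union>K)) U \<and> compact C"
    using V by blast
qed

section \<open>Approximation\<close>

text \<open>
  The neighbourhoods of the cover of \<open>X\<close> that drives the approximation. Each clause is shaped by
  what survives averaging over all \<open>x\<close> whose neighbourhood contains a given point \<open>x'\<close>. Since
  every simplex through \<open>F x' = \<Psi>' (f x')\<close> contains all these \<open>F x\<close>, their average lies in that
  simplex. The value \<open>F x'\<close> is within half of the radius \<open>\<eta>\<close>, so that two such \<open>F x\<close> are closer to
  each other than the larger of their radii. The errors of \<open>\<Psi>\<close> are measured by the tolerance at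
  \<open>x\<close>, which is less than twice the tolerance at \<open>x'\<close>; hence two errors of a quarter are allowed.
  Finally, points of \<open>X'\<close> are seen only from points of \<open>X'\<close> with the same value, which is possible
  because \<open>X'\<close> is closed and \<open>f ` X'\<close> is discrete.
\<close>

lemma adapted_neighbourhood:
  assumes L: "locally_finite_complex L" and hom: "homeomorphism (\<Union>L) Y \<Psi> \<Psi>'"
    and f: "continuous_on X f" "f ` X \<subseteq> Y" and \<epsilon>: "gauge_on X \<epsilon>"
    and X': "closedin (top_of_set X) X'" "discrete (f ` X')"
    and x: "x \<in> X"
  shows "\<exists>W \<eta>. open W \<and> x \<in> W \<and> \<eta> > 0 \<and>
    (\<forall>z\<in>\<Union>L. dist z (\<Psi>' (f x)) < \<eta> \<longrightarrow> dist (\<Psi> z) (f x) < \<epsilon> x / 4) \<and>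
    (\<forall>x'\<in>W \<inter> X. (\<forall>\<xi>\<in>L. \<Psi>' (f x') \<in> \<xi> \<longrightarrow> \<Psi>' (f x) \<in> \<xi>) \<and>
      dist (\<Psi>' (f x')) (\<Psi>' (f x)) < \<eta> / 2 \<and> \<epsilon> x / 2 < \<epsilon> x' \<and>
      (x' \<in> X' \<longrightarrow> x \<in> X' \<and> f x' = f x))"
proof -
  define F where "F x = \<Psi>' (f x)" for x
  have fx: "f x \<in> Y" using f(2) x by blast
  have F_in: "F x \<in> \<Union>L" and \<Psi>F: "\<Psi> (F x) = f x"
    using hom fx unfolding F_def homeomorphism_def by auto
  have \<epsilon>x: "\<epsilon> x > 0" using \<epsilon> x by (simp add: gauge_on_def)
  have contF: "continuous_on X F"
    unfolding F_def
    by (rule continuous_on_compose2[OF homeomorphism_cont2[OF hom] f])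
  obtain e where e: "e > 0" "\<And>\<xi> z. \<xi> \<in> L \<Longrightarrow> z \<in> \<xi> \<Longrightarrow> dist z (F x) < e \<Longrightarrow> F x \<in> \<xi>"
    using locally_finite_complex_star_ball[OF L F_in] by blast
  obtain \<eta> where \<eta>: "\<eta> > 0" "\<And>z. z \<in> \<Union>L \<Longrightarrow> dist z (F x) < \<eta> \<Longrightarrow> dist (\<Psi> z) (f x) < \<epsilon> x / 4"
  proof -
    have "\<epsilon> x / 4 > 0" using \<epsilon>x by simp
    then show thesis
      using homeomorphism_cont1[OF hom] F_in that unfolding continuous_on_iff \<Psi>F[symmetric]
      by metis
  qed
  have near_F: "\<forall>\<^sub>F x' in at x within X. dist (F x') (F x) < d" if "d > 0" for d
    using contF x that by (auto simp: continuous_on_def tendsto_iff)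
  have near_\<epsilon>: "\<forall>\<^sub>F x' in at x within X. \<epsilon> x / 2 < \<epsilon> x'"
    using \<epsilon> x \<epsilon>x order_tendstoD(1)[of \<epsilon> "\<epsilon> x" "at x within X" "\<epsilon> x / 2"]
    by (auto simp: gauge_on_def continuous_on_def)
  have near_X': "\<forall>\<^sub>F x' in at x within X. x' \<in> X' \<longrightarrow> x \<in> X' \<and> f x' = f x"
  proof (cases "x \<in> X'")
    case True
    then obtain d where d: "d > 0" "\<And>x'. x' \<in> X' \<Longrightarrow> dist (f x) (f x') < d \<Longrightarrow> f x' = f x"
      using discreteD[OF X'(2), of "f x"] by (auto simp: isolated_in_dist_Ex_iff)
    have "\<forall>\<^sub>F x' in at x within X. dist (f x') (f x) < d"
      using f(1) x d(1) by (auto simp: continuous_on_def tendsto_iff)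
    then show ?thesis
      by eventually_elim (use True d(2) in \<open>auto simp: dist_commute\<close>)
  next
    case False
    obtain C where C: "closed C" "X' = X \<inter> C"
      using X'(1) by (auto simp: closedin_closed)
    have "\<forall>\<^sub>F x' in at x within X. x' \<in> - C"
      using C False x by (intro topological_tendstoD[OF tendsto_ident_at]) auto
    then show ?thesis
      by eventually_elim (use C in auto)
  qed
  have "\<eta> / 2 > 0" using \<eta> by simp
  have "\<forall>\<^sub>F x' in at x within X. dist (F x') (F x) < e \<and> dist (F x') (F x) < \<eta> / 2 \<and>
      \<epsilon> x / 2 < \<epsilon> x' \<and> (x' \<in> X' \<longrightarrow> x \<in> X' \<and> f x' = f x)"
    by (intro eventually_conj near_F near_\<epsilon> near_X' e(1) \<open>\<eta> / 2 > 0\<close>)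
  then obtain W where W: "open W" "x \<in> W"
    "\<And>x'. x' \<in> W \<Longrightarrow> x' \<noteq> x \<Longrightarrow> x' \<in> X \<Longrightarrow> dist (F x') (F x) < e \<and>
      dist (F x') (F x) < \<eta> / 2 \<and> \<epsilon> x / 2 < \<epsilon> x' \<and> (x' \<in> X' \<longrightarrow> x \<in> X' \<and> f x' = f x)"
    by (auto simp: eventually_at_topological)
  have WX: "dist (F x') (F x) < e \<and> dist (F x') (F x) < \<eta> / 2 \<and> \<epsilon> x / 2 < \<epsilon> x' \<and>
      (x' \<in> X' \<longrightarrow> x \<in> X' \<and> f x' = f x)" if "x' \<in> W" "x' \<in> X" for x'
    using W(3)[OF that(1) _ that(2)] e(1) \<eta>(1) \<epsilon>x by (cases "x' = x") auto
  show ?thesis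
    using W(1,2) \<eta> WX e(2) unfolding F_def
    by (intro exI[of _ W] exI[of _ \<eta>]) blast
qed

text \<open>
  Averaging \<open>F = \<Psi>' \<circ> f\<close> over the adapted cover gives a smooth \<open>h\<close> that maps a neighbourhood of
  each point of \<open>X\<close>, taken in the ambient space, into one simplex. There \<open>\<Psi>\<close> agrees with a map of
  class \<open>C\<^sup>r\<close> on an open set, so \<open>\<Psi> \<circ> h\<close> is itself a globally defined \<open>C\<^sup>r\<close> extension of its
  restriction to \<open>X\<close>. Local compactness serves to find an open set in which \<open>X\<close> is closed.
\<close>

lemma Cr_approximation_rel:
  fixes X X' :: "'a::euclidean_space set" and Y :: "'b::euclidean_space set"
    and L :: "'q::euclidean_space set set"
  assumes "X \<noteq> {}" "locally compact X"
    and L: "locally_finite_complex L" and hom: "homeomorphism (\<Union>L) Y \<Psi> \<Psi>'"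
    and \<Psi>: "\<And>\<xi>. \<xi> \<in> L \<Longrightarrow> \<Psi> \<in> Cr_maps r \<xi> Y"
    and f: "f \<in> C0_maps X Y" and \<epsilon>: "gauge_on X \<epsilon>"
    and X': "closedin (top_of_set X) X'" "discrete (f ` X')"
  obtains g where "g \<in> Cr_maps r X Y" "g \<in> strong_nbhd X Y f \<epsilon>" "\<And>x. x \<in> X' \<Longrightarrow> g x = f x"
proof -
  have contf: "continuous_on X f" and fX: "f ` X \<subseteq> Y"
    using f by (auto simp: C0_maps_def)
  define F where "F x = \<Psi>' (f x)" for x
  have F_in: "F x \<in> \<Union>L" and \<Psi>F: "\<Psi> (F x) = f x" if "x \<in> X" for x
    using homeomorphism_image2[OF hom] homeomorphism_apply2[OF hom] fX that unfolding F_def by blast+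
  define good where "good x W \<eta> \<longleftrightarrow> open W \<and> x \<in> W \<and> \<eta> > 0 \<and>
    (\<forall>z\<in>\<Union>L. dist z (F x) < \<eta> \<longrightarrow> dist (\<Psi> z) (f x) < \<epsilon> x / 4) \<and>
    (\<forall>x'\<in>W \<inter> X. (\<forall>\<xi>\<in>L. F x' \<in> \<xi> \<longrightarrow> F x \<in> \<xi>) \<and>
      dist (F x') (F x) < \<eta> / 2 \<and> \<epsilon> x / 2 < \<epsilon> x' \<and> (x' \<in> X' \<longrightarrow> x \<in> X' \<and> f x' = f x))" for x W \<eta>
  have "\<exists>W \<eta>. good x W \<eta>" if "x \<in> X" for x
    unfolding good_def F_def by (rule adapted_neighbourhood[OF L hom contf fX \<epsilon> X' that])
  then obtain W \<eta> where good: "\<And>x. x \<in> X \<Longrightarrow> good x (W x) (\<eta> x)"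
    by metis
  then have W: "open (W x) \<and> x \<in> W x" if "x \<in> X" for x
    using that by (simp add: good_def)
  have \<Psi>_close: "dist (\<Psi> z) (f x) < \<epsilon> x / 4" if "x \<in> X" "z \<in> \<Union>L" "dist z (F x) < \<eta> x" for x z
    using good that unfolding good_def by blast
  have star: "F x \<in> \<xi>" if "x \<in> X" "x' \<in> X" "x' \<in> W x" "\<xi> \<in> L" "F x' \<in> \<xi>" for x x' \<xi>
    using good that unfolding good_def by blast
  have F_close: "dist (F x') (F x) < \<eta> x / 2"
    and \<epsilon>_close: "\<epsilon> x / 2 < \<epsilon> x'" if "x \<in> X" "x' \<in> X" "x' \<in> W x" for x x'
    using good that unfolding good_def by blast+
  have f_const: "f x = f x'" if "x \<in> X" "x' \<in> X" "x' \<in> W x" "x' \<in> X'" for x x'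
  proof -
    have "\<forall>x'\<in>W x \<inter> X. x' \<in> X' \<longrightarrow> f x' = f x"
      using good[OF that(1)] by (simp add: good_def)
    then show ?thesis using that by simp
  qed
  define loc where "loc h x0 N A \<longleftrightarrow> open N \<and> x0 \<in> N \<and> (\<forall>k. Ck_on k N h) \<and>
        finite A \<and> A \<subseteq> {x \<in> X. x0 \<in> W x} \<and> h ` N \<subseteq> convex hull (F ` A)" for h x0 N A
  have "\<exists>h. \<forall>x0\<in>X. \<exists>N A. loc h x0 N A"
    unfolding loc_def by (rule smooth_average[OF \<open>X \<noteq> {}\<close> W])
  then obtain h N A where loc: "\<And>x. x \<in> X \<Longrightarrow> loc h x (N x) (A x)"
    by metis
  have N: "open (N x)" "x \<in> N x" "Ck_on k (N x) h"
    and A: "finite (A x)" "A x \<subseteq> {x' \<in> X. x \<in> W x'}"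
    and hN: "h ` N x \<subseteq> convex hull (F ` A x)" if "x \<in> X" for x k
    using loc[OF that] by (simp_all add: loc_def)
  have h_hull: "h x \<in> convex hull (F ` A x)" if "x \<in> X" for x
    using hN[OF that] N(2)[OF that] by (rule subsetD[OF _ imageI])
  have h_simplex: "h ` N x \<subseteq> \<xi>" if "x \<in> X" "\<xi> \<in> L" "F x \<in> \<xi>" for x \<xi>
  proof -
    have "convex \<xi>"
      using L that(2) convex_simplex unfolding locally_finite_complex_def by blast
    moreover have "F ` A x \<subseteq> \<xi>"
      using A(2)[OF that(1)] star that by blast
    ultimately show ?thesis
      using hN[OF that(1)] hull_minimal[of "F ` A x" \<xi> convex] by blast
  qed
  define g where "g x = \<Psi> (h x)" for x
  define U0 where "U0 = (\<Union>x\<in>X. N x)"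
  obtain T where T: "open T" "closedin (top_of_set T) X"
    using locally_compact_closedin_open[OF \<open>locally compact X\<close>] .
  define U where "U = U0 \<inter> T"
  have "X \<subseteq> U"
    using N(2) closedin_imp_subset[OF T(2)] by (auto simp: U_def U0_def)
  have "open U"
    unfolding U_def U0_def using N(1) T(1) by blast
  have closedX: "closedin (top_of_set U) X"
    by (rule closedin_subset_trans[OF T(2) \<open>X \<subseteq> U\<close>]) (simp add: U_def)
  have Ck_g: "Ck_on k U g" if k: "enat k \<le> r" for k
  proof (rule Ck_on_locally)
    fix u assume "u \<in> U"
    then obtain x where x: "x \<in> X" "u \<in> N x" by (auto simp: U_def U0_def)
    obtain \<xi> where \<xi>: "\<xi> \<in> L" "F x \<in> \<xi>" using F_in[OF x(1)] by blast
    obtain V G where G: "open V" "closedin (top_of_set V) \<xi>" "Cr_on r V G"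
        "\<And>z. z \<in> \<xi> \<Longrightarrow> \<Psi> z = G z"
      using \<Psi>[OF \<xi>(1)] unfolding Cr_maps_def by blast
    have sub: "h ` N x \<subseteq> \<xi>" by (rule h_simplex[OF x(1) \<xi>])
    have "Ck_on k (N x) (\<lambda>y. G (h y))"
    proof (rule Ck_on_compose[OF N(1)[OF x(1)] G(1) _ _ N(3)[OF x(1)]])
      show "h ` N x \<subseteq> V" using sub closedin_imp_subset[OF G(2)] by blast
      show "Ck_on k V G" using G(3) k by (simp add: Cr_on_def)
    qed
    then have "Ck_on k (N x) g"
      by (rule Ck_on_cong[OF N(1)[OF x(1)], rotated]) (use sub G(4) in \<open>auto simp: g_def\<close>)
    then show "\<exists>N. open N \<and> u \<in> N \<and> Ck_on k N g"
      using N(1)[OF x(1)] x(2) by blast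
  qed
  have h_in: "h x \<in> \<Union>L" if x: "x \<in> X" for x
  proof -
    obtain \<xi> where \<xi>: "\<xi> \<in> L" "F x \<in> \<xi>" using F_in[OF x] by blast
    then have "h x \<in> \<xi>"
      by (rule subsetD[OF h_simplex[OF x] imageI[OF N(2)[OF x]]])
    then show ?thesis using \<xi>(1) by blast
  qed
  then have gX: "g ` X \<subseteq> Y"
    unfolding g_def homeomorphism_image1[OF hom, symmetric] by (intro image_subsetI imageI)
  have g_Cr: "g \<in> Cr_maps r X Y"
    unfolding Cr_maps_def Cr_on_def using gX \<open>open U\<close> closedX Ck_g by blast
  have "continuous_on X g"
    using Ck_g[of 0] \<open>X \<subseteq> U\<close> by (auto simp: zero_enat_def[symmetric] intro: continuous_on_subset)
  moreover have "norm (g x - f x) < \<epsilon> x" if x: "x \<in> X" for x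
  proof -
    have "A x \<noteq> {}" using h_hull[OF x] by auto
    \<comment> \<open>The ball attached to the index with the largest radius contains all values averaged at
      \<open>x\<close>: each of them is closer than half that radius to \<open>F x\<close>, and so is the centre.\<close>
    then have "Max (\<eta> ` A x) \<in> \<eta> ` A x" using A(1)[OF x] by (intro Max_in) auto
    then obtain m where "m \<in> A x" "\<eta> m = Max (\<eta> ` A x)" by auto
    then have m: "m \<in> A x" "\<And>x'. x' \<in> A x \<Longrightarrow> \<eta> x' \<le> \<eta> m"
      using A(1)[OF x] by simp_all
    then have mX: "m \<in> X" "x \<in> W m" using A(2)[OF x] by auto
    have Fx: "dist (F x) (F m) < \<eta> m / 2" by (rule F_close[OF mX(1) x mX(2)])
    have "F ` A x \<subseteq> ball (F m) (\<eta> m)"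
    proof clarify
      fix x' assume x': "x' \<in> A x"
      then have "dist (F x) (F x') < \<eta> x' / 2" using F_close A(2)[OF x] x by blast
      then have "dist (F m) (F x') < \<eta> m"
        using Fx m(2)[OF x'] dist_triangle2[of "F m" "F x'" "F x"] by (simp add: dist_commute)
      then show "F x' \<in> ball (F m) (\<eta> m)" by simp
    qed
    then have "h x \<in> ball (F m) (\<eta> m)"
      using h_hull[OF x] hull_minimal[of "F ` A x" _ convex] convex_ball by blast
    then have "dist (g x) (f m) < \<epsilon> m / 4"
      using \<Psi>_close[OF mX(1) h_in[OF x]] by (simp add: g_def dist_commute)
    moreover have "dist (f x) (f m) < \<epsilon> m / 4"
      using \<Psi>_close[OF mX(1) F_in[OF x]] Fx \<Psi>F[OF x] zero_le_dist[of "F x" "F m"] by simp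
    moreover have "\<epsilon> m / 2 < \<epsilon> x" by (rule \<epsilon>_close[OF mX(1) x mX(2)])
    ultimately show ?thesis
      using dist_triangle2[of "g x" "f x" "f m"] by (simp add: dist_norm)
  qed
  ultimately have g_near: "g \<in> strong_nbhd X Y f \<epsilon>"
    using gX by (simp add: strong_nbhd_def C0_maps_def)
  have "g x = f x" if "x \<in> X'" for x
  proof -
    have x: "x \<in> X" using that closedin_imp_subset[OF X'(1)] by blast
    have "f x' = f x" if "x' \<in> A x" for x'
      using f_const[of x' x] A(2)[OF x] x that \<open>x \<in> X'\<close> by auto
    then have "F ` A x \<subseteq> {F x}" by (auto simp: F_def)
    then have "h x = F x"
      using h_hull[OF x] hull_minimal[of "F ` A x" "{F x}" convex] by auto
    then show ?thesis using \<Psi>F[OF x] by (simp add: g_def)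
  qed
  then show thesis using that g_Cr g_near by blast
qed

theorem theorem1p24:
  fixes r :: enat
    and X X' :: "'m::euclidean_space set"
    and Y :: "'n::euclidean_space set"
    and f :: "'m \<Rightarrow> 'n"
  assumes "1 \<le> r"
    and "weakly_star_Cr_triangulable_pair TYPE('p::euclidean_space) r X X'"
    and "weakly_Cr_triangulable TYPE('q::euclidean_space) r Y"
    and "f \<in> C0_maps X Y"
    and "discrete (f ` X')"
    and "closedin (top_of_set Y) (f ` X')"
  shows "\<forall>W. openin (strong_C0_topology X Y) W \<and> f \<in> W \<longrightarrow>
           (\<exists>g \<in> Cr_maps r X Y. g \<in> W \<and> (\<forall>x\<in>X'. g x = f x))"
proof (intro allI impI)
  fix W assume W: "openin (strong_C0_topology X Y) W \<and> f \<in> W"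
  obtain \<epsilon> where \<epsilon>: "gauge_on X \<epsilon>" "strong_nbhd X Y f \<epsilon> \<subseteq> W"
    using strong_nbhd_subset_openin W by blast
  obtain K :: "'p set set" and \<Phi> \<Phi>' where X: "X \<noteq> {}" "closedin (top_of_set X) X'"
      "locally_finite_complex K" "homeomorphism (\<Union>K) X \<Phi> \<Phi>'"
    using assms(2) unfolding weakly_star_Cr_triangulable_pair_def by blast
  obtain L :: "'q set set" and \<Psi> \<Psi>' where Y: "locally_finite_complex L"
      "homeomorphism (\<Union>L) Y \<Psi> \<Psi>'" "\<And>\<xi>. \<xi> \<in> L \<Longrightarrow> \<Psi> \<in> Cr_maps r \<xi> Y"
    using assms(3) unfolding weakly_Cr_triangulable_def by blast
  have "locally compact X"
    using locally_compact_realization[OF X(3)] homeomorphic_local_compactness X(4)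
    unfolding homeomorphic_def by blast
  then obtain g where "g \<in> Cr_maps r X Y" "g \<in> strong_nbhd X Y f \<epsilon>" "\<And>x. x \<in> X' \<Longrightarrow> g x = f x"
    using Cr_approximation_rel[OF X(1) _ Y assms(4) \<epsilon>(1) X(2) assms(5)] by blast
  then show "\<exists>g \<in> Cr_maps r X Y. g \<in> W \<and> (\<forall>x\<in>X'. g x = f x)"
    using \<epsilon>(2) by blast
qed

end
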